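(* Let $m \ge 3$ be odd and $n = 3^m-1$. Then the dual code $\mathcal{C}_{(0,1,m)}^\perp$ has parameters $[n,k,d]$ with $d \ge \frac{3^{(m-1)/2}+9}{2}$ if $m \equiv 3 \pmod 4$ and $d \ge \frac{3^{(m-1)/2}+7}{2}$ if $m \equiv 1 \pmod 4$, and $k = \frac{n-2}{2}$ if $m \equiv 3 \pmod 4$ and $k = \frac{n}{2}$ if $m \equiv 1 \pmod 4$.
   Context: Let $m \ge 2$ be an integer, $n = 3^m-1$, and let $\alpha$ be a primitive element of $\mathbb{F}_{3^m}$. For an integer $0 \le j \le n-1$ with $3$-adic expansion $j = \sum_{t=0}^{m-1} j_t 3^t$, $j_t \in \{0,1,2\}$, let $w_3(j) = \sum_{t=0}^{m-1} j_t$. For distinct $i_1, i_2 \in \{0,1,2,3\}$ let $T_{(i_1,i_2,m)} = \{1 \le j \le n-1 : w_3(j) \equiv i_1 \text{ or } i_2 \pmod 4\}$ and $g_{(i_1,i_2,m)}(x) = \prod_{j \in T_{(i_1,i_2,m)}} (x - \alpha^j) \in \mathbb{F}_3[x]$. $\mathcal{C}_{(i_1,i_2,m)}$ denotes the ternary cyclic code of length $n$ with generator polynomial $g_{(i_1,i_2,m)}(x)$, and $\mathcal{C}^\perp$ denotes the dual code with respect to the standard inner product on $\mathbb{F}_3^n$. Parameters $[n,k,d]$ mean length, dimension over $\mathbb{F}_3$, and minimum Hamming distance. *)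

theory Defs
  imports "HOL-Computational_Algebra.Polynomial" Complex_Main
begin

fun w3 :: "nat \<Rightarrow> nat" where
  "w3 j = (if j = 0 then 0 else j mod 3 + w3 (j div 3))"

text \<open>The prime subfield F_3 inside the field 'a (of characteristic 3).\<close>
definition prime_subfield :: "'a::field set" where
  "prime_subfield = range of_nat"

definition primitive_elem :: "'a::field \<Rightarrow> bool" where
  "primitive_elem \<alpha> \<longleftrightarrow> \<alpha> \<noteq> 0 \<and> (\<forall>x. x \<noteq> 0 \<longrightarrow> (\<exists>i::nat. x = \<alpha> ^ i))"

definition words :: "nat \<Rightarrow> (nat \<Rightarrow> 'a::field) set" where
  "words n = {c. (\<forall>i. c i \<in> prime_subfield) \<and> (\<forall>i\<ge>n. c i = 0)}"

definition T_set :: "nat \<Rightarrow> nat \<Rightarrow> nat \<Rightarrow> nat set" where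
  "T_set i1 i2 m = {j. 1 \<le> j \<and> j \<le> 3^m - 2 \<and> (w3 j mod 4 = i1 \<or> w3 j mod 4 = i2)}"

definition gen_poly :: "'a::field \<Rightarrow> nat \<Rightarrow> nat \<Rightarrow> nat \<Rightarrow> 'a poly" where
  "gen_poly \<alpha> i1 i2 m = (\<Prod>j\<in>T_set i1 i2 m. [:- (\<alpha> ^ j), 1:])"

definition word_poly :: "nat \<Rightarrow> (nat \<Rightarrow> 'a::field) \<Rightarrow> 'a poly" where
  "word_poly n c = (\<Sum>i<n. monom (c i) i)"

definition cyc_code :: "'a::field \<Rightarrow> nat \<Rightarrow> nat \<Rightarrow> nat \<Rightarrow> (nat \<Rightarrow> 'a) set" where
  "cyc_code \<alpha> i1 i2 m =
     {c \<in> words (3^m - 1). gen_poly \<alpha> i1 i2 m dvd word_poly (3^m - 1) c}"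

definition dual_code :: "nat \<Rightarrow> (nat \<Rightarrow> 'a::field) set \<Rightarrow> (nat \<Rightarrow> 'a) set" where
  "dual_code n C = {v \<in> words n. \<forall>c\<in>C. (\<Sum>i<n. v i * c i) = 0}"

definition hweight :: "nat \<Rightarrow> (nat \<Rightarrow> 'a::zero) \<Rightarrow> nat" where
  "hweight n c = card {i. i < n \<and> c i \<noteq> 0}"

definition min_dist :: "nat \<Rightarrow> (nat \<Rightarrow> 'a::zero) set \<Rightarrow> nat" where
  "min_dist n C = Min {hweight n c | c. c \<in> C \<and> c \<noteq> (\<lambda>_. 0)}"

text \<open>Dimension over F_3 of a linear code C (an F_3-subspace): |C| = 3^k.\<close>
definition code_dim :: "(nat \<Rightarrow> 'a) set \<Rightarrow> nat" where
  "code_dim C = (THE k. card C = 3 ^ k)"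

end

theory Submission
  imports Defs
begin

text \<open>
  Let \<open>h = (m - 1) / 2\<close> and let \<open>Z\<close> be the set of \<open>z < 3 ^ m\<close> with \<open>w3 z\<close> congruent to \<open>0\<close> or \<open>3\<close>
  modulo \<open>4\<close>. Because \<open>w3 (n - j) = 2 m - w3 j\<close> and \<open>2 m\<close> is \<open>2\<close> modulo \<open>4\<close>, the dual code
  consists of the words vanishing at \<open>\<alpha> ^ z\<close> for \<open>z \<in> Z\<close>, so its dimension is \<open>n - card Z\<close>.

  For the distance, write a word of length \<open>n = 2 N\<close> as two halves \<open>(a, b)\<close>. The step
  \<open>s = 3 ^ h - 1\<close> satisfies \<open>gcd s n = 2\<close>, so a progression in \<open>Z\<close> with step \<open>s\<close> yields the BCH bound
  for \<open>a + b\<close> if its terms are even and for \<open>a - b\<close> if they are odd. Even terms give weight at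
  least \<open>3 ^ h + 1\<close> whenever \<open>a + b \<noteq> 0\<close>. Otherwise \<open>b = - a\<close>, and a progression of
  odd terms bounds the weight of \<open>a\<close>, that is half of the weight of the word. Such progressions
  exist since \<open>k * 3 ^ h + (3 ^ g - 1 - k)\<close> has digit sum \<open>2 g\<close> for all \<open>k < 3 ^ g\<close>, \<open>g \<le> h\<close>.
  Only for \<open>m = 3\<close> is this too weak; there the exponents \<open>5, 0, 21, 16, 11\<close>, in
  progression modulo \<open>26\<close>, give the bound.
\<close>

section \<open>Ternary digit sums\<close>

declare w3.simps [simp del]

lemma w3_0 [simp]: "w3 0 = 0"
  by (simp add: w3.simps)

lemma w3_digit: "d < 3 \<Longrightarrow> w3 (d + 3 * r) = d + w3 r"
  by (subst w3.simps) auto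

lemma w3_small: "d < 3 \<Longrightarrow> w3 d = d"
  using w3_digit[of d 0] by simp

text \<open>The summand \<open>3 ^ k * d\<close> has no digits below position \<open>k\<close>, so
  the addition produces no carry.\<close>

lemma w3_append: "r < 3 ^ k \<Longrightarrow> w3 (r + 3 ^ k * d) = w3 r + w3 d"
proof (induction k arbitrary: r)
  case (Suc k)
  define a b where "a = r mod 3" and "b = r div 3"
  have r: "r = a + 3 * b" and a: "a < 3" and b: "b < 3 ^ k"
    using Suc.prems by (auto simp: a_def b_def)
  have "w3 (r + 3 ^ Suc k * d) = w3 (a + 3 * (b + 3 ^ k * d))"
    by (simp add: r algebra_simps)
  also have "\<dots> = a + (w3 b + w3 d)"
    by (simp only: w3_digit[OF a] Suc.IH[OF b])
  finally show ?case
    by (simp add: r w3_digit[OF a])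
qed simp

text \<open>All digits of \<open>3 ^ k - 1\<close> are 2, so the subtraction turns each digit
  \<open>a\<close> into \<open>2 - a\<close> without a borrow.\<close>

lemma w3_complement: "r < 3 ^ k \<Longrightarrow> w3 (3 ^ k - 1 - r) + w3 r = 2 * k"
proof (induction k arbitrary: r)
  case (Suc k)
  define a b where "a = r mod 3" and "b = r div 3"
  have r: "r = a + 3 * b" and a: "a < 3" and b: "b < 3 ^ k"
    using Suc.prems by (auto simp: a_def b_def)
  have "3 ^ Suc k - 1 - r = (2 - a) + 3 * (3 ^ k - 1 - b)"
    using a b by (simp add: r)
  moreover have "2 - a < 3"
    by simp
  ultimately have "w3 (3 ^ Suc k - 1 - r) + w3 r = (2 - a) + w3 (3 ^ k - 1 - b) + (a + w3 b)"
    by (simp only: r w3_digit a)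
  with Suc.IH[OF b] a show ?case
    by simp
qed simp

text \<open>Since \<open>(3 ^ h - 1) * k\<close> is \<open>k * 3 ^ h - k\<close>, the number
  consists of the \<open>g\<close>-digit complement of \<open>k\<close> at the bottom,
  \<open>k\<close> from position \<open>h\<close> and \<open>E\<close> from position
  \<open>h + g\<close>. The first two blocks contribute \<open>2 * g\<close> whatever
  \<open>k\<close> is, so the digit sum stays constant along the progression.\<close>

lemma w3_complementary_blocks:
  assumes "k < 3 ^ g" "g \<le> h"
  shows "w3 (3 ^ g - 1 + 3 ^ (h + g) * E + (3 ^ h - 1) * k) = 2 * g + w3 E"
proof -
  have h: "(3::nat) ^ g \<le> 3 ^ h"
    using assms by (simp add: power_increasing)
  obtain u where u: "(3::nat) ^ h = Suc u"
    by (metis gr0_conv_Suc zero_less_numeral zero_less_power)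
  have "3 ^ g - 1 + 3 ^ (h + g) * E + (3 ^ h - 1) * k
      = (3 ^ g - 1 - k) + 3 ^ h * (k + 3 ^ g * E)"
    using assms(1) by (simp add: algebra_simps power_add u)
  moreover have "3 ^ g - 1 - k < 3 ^ h"
    using h assms(1) by linarith
  ultimately have "w3 (3 ^ g - 1 + 3 ^ (h + g) * E + (3 ^ h - 1) * k)
      = w3 (3 ^ g - 1 - k) + (w3 k + w3 E)"
    by (simp only: w3_append assms)
  with w3_complement[OF assms(1)] show ?thesis
    by simp
qed

text \<open>Multiplication by 3 modulo \<open>3 ^ Suc k - 1\<close> moves the top digit to the
  bottom, which only permutes the digits.\<close>

lemma w3_rotate:
  assumes "z < 3 ^ Suc k - 1"
  obtains z' t where "z' < 3 ^ Suc k - 1" "w3 z' = w3 z" "3 * z = z' + t * (3 ^ Suc k - 1)"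
proof -
  define r d where "r = z mod 3 ^ k" and "d = z div 3 ^ k"
  have z: "z = r + 3 ^ k * d" and r: "r < 3 ^ k"
    by (auto simp: r_def d_def)
  have d: "d < 3"
    using assms by (simp add: d_def div_less_iff_less_mult)
  have w: "w3 (d + 3 * r) = w3 z"
    using d r by (simp add: z w3_append w3_digit w3_small)
  have eq: "3 * z = (d + 3 * r) + d * (3 ^ Suc k - 1)"
  proof -
    obtain u :: nat where u: "3 ^ Suc k = Suc u"
      by (metis gr0_conv_Suc zero_less_numeral zero_less_power)
    have "3 * z = 3 * r + 3 ^ Suc k * d"
      by (simp add: z)
    thus ?thesis
      unfolding u by simp
  qed
  \<comment> \<open>Equality would force all digits to be 2, and the hypothesis excludes that value
    of \<open>z\<close>.\<close>
  have "d + 3 * r \<noteq> 3 ^ Suc k - 1"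
  proof
    assume *: "d + 3 * r = 3 ^ Suc k - 1"
    hence "Suc d + 3 * r = 3 * 3 ^ k"
      by simp
    hence "3 dvd Suc d + 3 * r"
      by simp
    hence "d = 2"
      using d by presburger
    with * assms show False
      by (simp add: z)
  qed
  moreover have "d + 3 * r \<le> 3 ^ Suc k - 1"
    using d r by simp
  ultimately show thesis
    using that[OF _ w eq] by linarith
qed

section \<open>Counting numbers by digit sum modulo 4\<close>

definition w3_count :: "nat \<Rightarrow> nat \<Rightarrow> nat" where
  "w3_count m r = card {z. z < 3 ^ m \<and> w3 z mod 4 = r}"

text \<open>The lowest digit is 0, 1 or 2 and the other \<open>m\<close> digits make up the
  difference; \<open>r + 3\<close> and \<open>r + 2\<close> stand for \<open>r - 1\<close> and
  \<open>r - 2\<close> modulo 4.\<close>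

lemma w3_count_Suc:
  assumes "r < 4"
  shows "w3_count (Suc m) r
    = w3_count m r + w3_count m ((r + 3) mod 4) + w3_count m ((r + 2) mod 4)"
proof -
  define A where "A d = {b. b < (3::nat) ^ m \<and> w3 b mod 4 = (r + 4 - d) mod 4}" for d
  have mod4: "(d + w) mod 4 = r \<longleftrightarrow> w mod 4 = (r + 4 - d) mod 4" if "d < 3" for d w
  proof
    assume "(d + w) mod 4 = r"
    hence "(r + 4 - d) mod 4 = ((d + w) mod 4 + (4 - d)) mod 4"
      using that by simp
    also have "\<dots> = (d + w + (4 - d)) mod 4"
      by (rule mod_add_left_eq)
    also have "\<dots> = w mod 4"
      using that by simp
    finally show "w mod 4 = (r + 4 - d) mod 4" ..
  next
    assume "w mod 4 = (r + 4 - d) mod 4"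
    hence "(d + w) mod 4 = (d + (r + 4 - d)) mod 4"
      by (metis mod_add_right_eq)
    also have "\<dots> = r"
      using that assms by simp
    finally show "(d + w) mod 4 = r" .
  qed
  have split: "{z. z < 3 ^ Suc m \<and> w3 z mod 4 = r} = (\<Union>d\<in>{..<3}. (\<lambda>b. d + 3 * b) ` A d)"
  proof (intro equalityI subsetI)
    fix z assume z: "z \<in> {z. z < 3 ^ Suc m \<and> w3 z mod 4 = r}"
    define d b where "d = z mod 3" and "b = z div 3"
    have zd: "z = d + 3 * b" "d < 3" and b: "b < 3 ^ m"
      using z by (auto simp: d_def b_def)
    have "(d + w3 b) mod 4 = r"
      using z w3_digit[OF zd(2), of b] by (simp add: zd(1))
    hence "w3 b mod 4 = (r + 4 - d) mod 4"
      using mod4 zd(2) by blast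
    thus "z \<in> (\<Union>d\<in>{..<3}. (\<lambda>b. d + 3 * b) ` A d)"
      using zd b by (auto simp: A_def)
  next
    fix z assume "z \<in> (\<Union>d\<in>{..<3}. (\<lambda>b. d + 3 * b) ` A d)"
    then obtain d b where d: "d < 3" and b: "b < 3 ^ m" "w3 b mod 4 = (r + 4 - d) mod 4"
      and z: "z = d + 3 * b"
      by (auto simp: A_def)
    have "(d + w3 b) mod 4 = r"
      using b(2) d mod4 by blast
    thus "z \<in> {z. z < 3 ^ Suc m \<and> w3 z mod 4 = r}"
      using d b(1) by (simp add: z w3_digit)
  qed
  have fin: "finite (A d)" for d
    by (simp add: A_def)
  have disj: "d = d'" if "d + 3 * b = d' + 3 * b'" "d < 3" "d' < 3" for d d' b b' :: nat
    using that by (metis mod_less mod_mult_self2)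
  have "w3_count (Suc m) r = (\<Sum>d<3. card ((\<lambda>b. d + 3 * b) ` A d))"
    unfolding w3_count_def split
    by (rule card_UN_disjoint) (auto simp: fin disj)
  also have "\<dots> = (\<Sum>d<3. card (A d))"
    by (intro sum.cong card_image) (auto simp: inj_on_def)
  also have "\<dots> = card (A 0) + card (A 1) + card (A 2)"
    by (simp add: eval_nat_numeral)
  finally show ?thesis
    using assms by (simp add: A_def w3_count_def add.commute)
qed

lemma w3_count_Suc_numeral:
  "w3_count (Suc m) 0 = w3_count m 0 + w3_count m 3 + w3_count m 2"
  "w3_count (Suc m) 1 = w3_count m 1 + w3_count m 0 + w3_count m 3"
  "w3_count (Suc m) 2 = w3_count m 2 + w3_count m 1 + w3_count m 0"
  "w3_count (Suc m) 3 = w3_count m 3 + w3_count m 2 + w3_count m 1"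
  using w3_count_Suc[of 0 m] w3_count_Suc[of 1 m] w3_count_Suc[of 2 m] w3_count_Suc[of 3 m]
  by (simp_all add: numeral_2_eq_2 [symmetric])

text \<open>With the four counts as coefficients of a polynomial modulo x^4 - 1, a further digit
  multiplies by 1 + x + x^2 = (1 + x + x^2 + x^3) - x^3. Up to multiples of the all-one vector this
  is multiplication by -x^3, whose fourth power is 1. Hence the deviation from uniformity has period
  4; here class 3 falls short by one.\<close>

lemma w3_count_1_mod_4:
  "w3_count (4 * k + 1) 0 = w3_count (4 * k + 1) 3 + 1 \<and>
   w3_count (4 * k + 1) 1 = w3_count (4 * k + 1) 3 + 1 \<and>
   w3_count (4 * k + 1) 2 = w3_count (4 * k + 1) 3 + 1 \<and>
   3 ^ (4 * k + 1) = 4 * w3_count (4 * k + 1) 3 + 3"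
proof (induction k)
  case 0
  have "w3_count 0 r = (if r = 0 then 1 else 0)" for r
  proof -
    have "{z. z < 3 ^ 0 \<and> w3 z mod 4 = r} = (if r = 0 then {0} else {})"
      by auto
    thus ?thesis
      by (simp add: w3_count_def)
  qed
  thus ?case
    by (simp add: w3_count_Suc)
next
  case (Suc k)
  define M where "M = 4 * k + 1"
  have "4 * Suc k + 1 = Suc (Suc (Suc (Suc M)))"
    by (simp add: M_def)
  moreover have "w3_count M 0 = w3_count M 3 + 1" "w3_count M 1 = w3_count M 3 + 1"
    "w3_count M 2 = w3_count M 3 + 1" "3 ^ M = 4 * w3_count M 3 + 3"
    using Suc.IH unfolding M_def by blast+
  ultimately show ?case
    by (simp only: w3_count_Suc_numeral power_Suc) simp
qed

text \<open>Two more digits move the deficit from class 3 to class 1, so classes 0 and 3 have the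
  common size.\<close>

lemma w3_count_3_mod_4:
  "4 * w3_count (4 * k + 3) 0 = 3 ^ (4 * k + 3) + 1 \<and>
   4 * w3_count (4 * k + 3) 3 = 3 ^ (4 * k + 3) + 1"
proof -
  define M where "M = 4 * k + 1"
  have "4 * k + 3 = Suc (Suc M)"
    by (simp add: M_def)
  moreover have "w3_count M 0 = w3_count M 3 + 1" "w3_count M 1 = w3_count M 3 + 1"
    "w3_count M 2 = w3_count M 3 + 1" "3 ^ M = 4 * w3_count M 3 + 3"
    using w3_count_1_mod_4[of k] unfolding M_def by blast+
  ultimately show ?thesis
    by (simp only: w3_count_Suc_numeral power_Suc) simp
qed

section \<open>Vanishing power sums and products of linear factors\<close>

lemma dvd_int_diff_imp_eq:
  assumes "int k dvd int i - int j" "i < k" "j < k"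
  shows "i = j"
proof -
  have "int k dvd int j - int i"
    using assms(1) by (simp add: dvd_diff_commute)
  with assms show ?thesis
    using zdvd_imp_le[of "int k" "int i - int j"] zdvd_imp_le[of "int k" "int j - int i"]
    by linarith
qed

text \<open>If the support had at most \<open>\<delta>\<close> points, the polynomial
  \<open>p\<close> vanishing at all its locators except that of \<open>i0\<close> would have degree
  below \<open>\<delta>\<close>. The sum of \<open>f i * poly p (x i)\<close> would then be 0 by the
  power sums, although only the nonzero term at \<open>i0\<close> remains.\<close>

lemma vandermonde_weight_bound:
  fixes f x :: "'b \<Rightarrow> 'a::field"
  assumes "finite I" "inj_on x I" "\<And>k. k < \<delta> \<Longrightarrow> (\<Sum>i\<in>I. f i * x i ^ k) = 0"
    and "i0 \<in> I" "f i0 \<noteq> 0"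
  shows "card {i\<in>I. f i \<noteq> 0} > \<delta>"
proof (rule ccontr)
  assume "\<not> \<delta> < card {i\<in>I. f i \<noteq> 0}"
  define S where "S = {i\<in>I. f i \<noteq> 0}"
  have S: "finite S" "i0 \<in> S" "card S \<le> \<delta>"
    using assms \<open>\<not> \<delta> < _\<close> by (auto simp: S_def)
  define p where "p = (\<Prod>i\<in>S - {i0}. [:- x i, 1:])"
  have p_eq_0: "poly p (x i) = 0" if "i \<in> S - {i0}" for i
    using that S by (auto simp: p_def poly_prod)
  have "poly p (x i0) \<noteq> 0"
    using S assms(2) by (auto simp: p_def poly_prod inj_on_def S_def)
  have "degree p = card S - 1"
    using S by (simp add: p_def degree_prod_eq_sum_degree)
  hence deg: "degree p < \<delta>"
    using S card_gt_0_iff[of S] by fastforce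
  have "(\<Sum>i\<in>I. f i * poly p (x i)) = (\<Sum>k\<le>degree p. coeff p k * (\<Sum>i\<in>I. f i * x i ^ k))"
    unfolding poly_altdef sum_distrib_left
    by (subst sum.swap) (simp add: mult_ac)
  also have "\<dots> = 0"
    using deg assms(3) by simp
  also have "(\<Sum>i\<in>I. f i * poly p (x i)) = (\<Sum>i\<in>{i0}. f i * poly p (x i))"
    using assms(1,4) p_eq_0 by (intro sum.mono_neutral_right) (auto simp: S_def)
  finally show False
    using \<open>poly p (x i0) \<noteq> 0\<close> assms(5) by simp
qed

lemma prod_linear_dvd_iff:
  fixes p :: "'a::field poly"
  assumes "finite A"
  shows "(\<Prod>a\<in>A. [:- a, 1:]) dvd p \<longleftrightarrow> (\<forall>a\<in>A. poly p a = 0)"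
  using assms
proof (induction A arbitrary: p rule: finite_induct)
  case (insert a A)
  show ?case
  proof
    assume "(\<Prod>a\<in>insert a A. [:- a, 1:]) dvd p"
    then obtain q where "p = (\<Prod>a\<in>insert a A. [:- a, 1:]) * q"
      by (elim dvdE)
    thus "\<forall>a\<in>insert a A. poly p a = 0"
      using insert.hyps by (auto simp: poly_prod)
  next
    assume *: "\<forall>a\<in>insert a A. poly p a = 0"
    then obtain q where q: "p = [:- a, 1:] * q"
      by (auto simp: poly_eq_0_iff_dvd elim!: dvdE)
    have "\<forall>b\<in>A. poly q b = 0"
      using * insert.hyps by (auto simp: q)
    hence "(\<Prod>a\<in>A. [:- a, 1:]) dvd q"
      using insert.IH by blast
    thus "(\<Prod>a\<in>insert a A. [:- a, 1:]) dvd p"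
      unfolding q prod.insert[OF insert.hyps] by (intro mult_dvd_mono dvd_refl)
  qed
qed simp

lemma poly_word_poly: "poly (word_poly n c) x = (\<Sum>i<n. c i * x ^ i)"
  by (simp add: word_poly_def poly_sum poly_monom)

lemma coeff_word_poly: "coeff (word_poly n c) i = (if i < n then c i else 0)"
  by (simp add: word_poly_def coeff_sum if_distrib cong: if_cong)

declare One_nat_def [simp del] \<comment> \<open>keeps \<open>T_set 0 1 m\<close> and \<open>cyc_code \<alpha> 0 1 m\<close> in this form\<close>

section \<open>The field of order 3 ^ m, its prime subfield and its trace\<close>

locale ternary_primitive =
  fixes \<alpha> :: "'a::{field,finite}" and m :: nat
  assumes card_field: "card (UNIV :: 'a set) = 3 ^ m"
    and prim: "primitive_elem \<alpha>"
    and odd_m: "odd m"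
begin

definition n :: nat where "n = 3 ^ m - 1"

lemma three_power_m: "3 ^ m = Suc n"
  by (simp add: n_def)

text \<open>These are the negatives modulo \<open>n\<close> of the exponents below \<open>n\<close>
  outside \<open>T_set 0 1 m\<close>. The bound \<open>3 ^ m\<close> admits \<open>n\<close>, but
  the digit sum \<open>2 * m\<close> of \<open>n\<close> is 2 modulo 4 and rules it out.\<close>

definition Z :: "nat set" where
  "Z = {z. z < 3 ^ m \<and> (w3 z mod 4 = 0 \<or> w3 z mod 4 = 3)}"

lemma m_pos: "m > 0"
  using odd_m by (cases m) auto

lemma n_ge_2: "n \<ge> 2"
proof -
  have "(3::nat) ^ 1 \<le> 3 ^ m"
    using m_pos by (intro power_increasing) auto
  thus ?thesis
    by (simp add: n_def)
qed

text \<open>Translation by 1 permutes the field, so comparing the sums of all elements gives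
  \<open>3 ^ m\<close> = 0, and a field has no nilpotents.\<close>

lemma three_eq_0: "(3::'a) = 0"
proof -
  have "(\<Sum>x::'a\<in>UNIV. x + 1) = (\<Sum>x\<in>UNIV. x)"
    by (rule sum.reindex_bij_witness[of _ "\<lambda>x. x - 1" "\<lambda>x. x + 1"]) auto
  hence "of_nat (3 ^ m) = (0::'a)"
    by (simp add: sum.distrib card_field)
  thus ?thesis
    by simp
qed

lemma cube_add: "(x + y :: 'a) ^ 3 = x ^ 3 + y ^ 3"
proof -
  have "(x + y) ^ 3 = x ^ 3 + y ^ 3 + 3 * (x ^ 2 * y + x * y ^ 2)"
    by (simp add: power3_eq_cube power2_eq_square algebra_simps)
  thus ?thesis
    by (simp add: three_eq_0)
qed

lemma cube_sum: "(\<Sum>i\<in>I. f i :: 'a) ^ 3 = (\<Sum>i\<in>I. f i ^ 3)"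
  by (induction I rule: infinite_finite_induct) (auto simp: cube_add)

lemma frobenius_sum: "(\<Sum>i\<in>I. f i :: 'a) ^ (3 ^ t) = (\<Sum>i\<in>I. f i ^ (3 ^ t))"
proof (induction t)
  case (Suc t)
  have "(\<Sum>i\<in>I. f i) ^ (3 ^ Suc t) = ((\<Sum>i\<in>I. f i) ^ (3 ^ t)) ^ 3"
    by (simp add: power_mult [symmetric] mult.commute)
  also have "\<dots> = (\<Sum>i\<in>I. f i ^ (3 ^ Suc t))"
    by (simp add: Suc.IH cube_sum power_mult [symmetric] mult.commute)
  finally show ?case .
qed simp

lemma two_eq: "(2::'a) = - 1"
proof -
  have "(2::'a) = 3 - 1"
    by simp
  thus ?thesis
    by (simp only: three_eq_0 diff_0)
qed

lemma prime_subfield_eq: "(prime_subfield :: 'a set) = {0, 1, - 1}"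
proof (intro equalityI subsetI)
  fix x :: 'a assume "x \<in> prime_subfield"
  then obtain k where x: "x = of_nat k"
    by (auto simp: prime_subfield_def)
  have "of_nat k \<in> {0, 1, - 1 :: 'a}"
    by (induction k) (use two_eq in auto)
  thus "x \<in> {0, 1, - 1}"
    by (simp add: x)
next
  fix x :: 'a assume "x \<in> {0, 1, - 1}"
  hence "x = of_nat 0 \<or> x = of_nat 1 \<or> x = of_nat 2"
    using two_eq by auto
  thus "x \<in> prime_subfield"
    unfolding prime_subfield_def by blast
qed

lemma zero_in_prime_subfield: "(0 :: 'a) \<in> prime_subfield"
  by (simp add: prime_subfield_eq)

lemma mem_prime_subfield_iff: "(x :: 'a) \<in> prime_subfield \<longleftrightarrow> x ^ 3 = x"
proof -
  have "x ^ 3 - x = x * ((x - 1) * (x + 1))"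
    by (simp add: power3_eq_cube algebra_simps)
  hence "x ^ 3 = x \<longleftrightarrow> x * ((x - 1) * (x + 1)) = 0"
    by (metis eq_iff_diff_eq_0)
  thus ?thesis
    by (simp add: prime_subfield_eq eq_neg_iff_add_eq_0)
qed

lemma card_prime_subfield: "card (prime_subfield :: 'a set) = 3"
proof -
  have "(1::'a) \<noteq> - 1"
    using two_eq by (metis add.inverse_inverse add_cancel_right_left one_add_one zero_neq_one)
  thus ?thesis
    by (simp add: prime_subfield_eq)
qed

lemma prime_subfield_frobenius:
  assumes "(x :: 'a) \<in> prime_subfield"
  shows "x ^ (3 ^ t) = x"
  using assms by (induction t) (auto simp: power_mult mem_prime_subfield_iff)

lemma alpha_nonzero [simp]: "\<alpha> \<noteq> 0"
  using prim by (simp add: primitive_elem_def)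

text \<open>Let \<open>r\<close> be the order of \<open>\<alpha>\<close>. The powers with exponent
  below \<open>r\<close> are distinct and, by primitivity, exhaust the nonzero elements; hence
  \<open>r = n\<close>.\<close>

lemma alpha_power_n: "\<alpha> ^ n = 1" and alpha_power_inj: "inj_on ((^) \<alpha>) {..<n}"
proof -
  have "\<not> inj (\<lambda>i::nat. \<alpha> ^ i)"
    using finite_imageD[of "\<lambda>i::nat. \<alpha> ^ i" UNIV] by auto
  then obtain i j where "i < j" "\<alpha> ^ i = \<alpha> ^ j"
    unfolding inj_def by (metis linorder_neqE_nat)
  moreover from \<open>i < j\<close> have "\<alpha> ^ j = \<alpha> ^ i * \<alpha> ^ (j - i)"
    by (simp add: power_add [symmetric])
  ultimately have "j - i > 0 \<and> \<alpha> ^ (j - i) = 1"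
    by simp
  hence ex: "\<exists>r. r > 0 \<and> \<alpha> ^ r = 1" ..
  define r where "r = (LEAST r. r > 0 \<and> \<alpha> ^ r = 1)"
  have r: "r > 0" "\<alpha> ^ r = 1"
    using LeastI_ex[OF ex] by (auto simp: r_def)
  have least: "\<alpha> ^ k \<noteq> 1" if "0 < k" "k < r" for k
    using not_less_Least[of k "\<lambda>r. r > 0 \<and> \<alpha> ^ r = 1"] that by (auto simp: r_def)
  have inj: "inj_on (\<lambda>i. \<alpha> ^ i) {..<r}"
  proof (rule linorder_inj_onI')
    fix i j assume "i \<in> {..<r}" "j \<in> {..<r}" "i < j"
    moreover from \<open>i < j\<close> have "\<alpha> ^ j = \<alpha> ^ i * \<alpha> ^ (j - i)"
      by (simp add: power_add [symmetric])
    ultimately show "\<alpha> ^ i \<noteq> \<alpha> ^ j"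
      using least[of "j - i"] by auto
  qed
  have red: "\<alpha> ^ i = \<alpha> ^ (i mod r)" for i
  proof -
    have "\<alpha> ^ i = \<alpha> ^ (r * (i div r) + i mod r)"
      by simp
    also have "\<dots> = \<alpha> ^ (i mod r)"
      by (simp only: power_add power_mult r(2)) simp
    finally show ?thesis .
  qed
  have "(\<lambda>i. \<alpha> ^ i) ` {..<r} = UNIV - {0}"
  proof (intro equalityI subsetI)
    fix x :: 'a assume "x \<in> UNIV - {0}"
    then obtain i where "x = \<alpha> ^ i"
      using prim by (auto simp: primitive_elem_def)
    with red[of i] r(1) show "x \<in> (\<lambda>i. \<alpha> ^ i) ` {..<r}"
      by auto
  qed auto
  with card_image[OF inj] have "r = n"
    by (simp add: card_Diff_subset card_field n_def)
  with r inj show "\<alpha> ^ n = 1" "inj_on ((^) \<alpha>) {..<n}"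
    by auto
qed

lemma alpha_power_eq_1_iff: "\<alpha> ^ i = 1 \<longleftrightarrow> n dvd i"
proof
  assume "n dvd i"
  thus "\<alpha> ^ i = 1"
    by (elim dvdE) (simp only: power_mult alpha_power_n power_one)
next
  assume *: "\<alpha> ^ i = 1"
  have "\<alpha> ^ i = \<alpha> ^ (n * (i div n) + i mod n)"
    by simp
  also have "\<dots> = \<alpha> ^ (i mod n)"
    by (simp only: power_add power_mult alpha_power_n) simp
  finally have "\<alpha> ^ (i mod n) = \<alpha> ^ 0"
    using * by simp
  hence "i mod n = 0"
    using inj_onD[OF alpha_power_inj] n_ge_2 by (metis (no_types, lifting) lessThan_iff
        mod_less_divisor less_le_trans pos2)
  thus "n dvd i"
    by auto
qed

lemma alpha_power_eq_iff: "\<alpha> ^ i = \<alpha> ^ j \<longleftrightarrow> int n dvd int i - int j"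
proof -
  have *: "\<alpha> ^ i = \<alpha> ^ j \<longleftrightarrow> int n dvd int i - int j" if "j \<le> i" for i j
  proof -
    have "\<alpha> ^ i = \<alpha> ^ j * \<alpha> ^ (i - j)"
      using that by (simp add: power_add [symmetric])
    hence "\<alpha> ^ i = \<alpha> ^ j \<longleftrightarrow> n dvd i - j"
      using alpha_power_eq_1_iff[of "i - j"] by simp
    also have "\<dots> \<longleftrightarrow> int n dvd int (i - j)"
      by (simp only: int_dvd_int_iff)
    finally show ?thesis
      using that by (simp add: of_nat_diff)
  qed
  show ?thesis
    using *[of i j] *[of j i] by (cases "j \<le> i") (auto simp: dvd_diff_commute eq_commute)
qed

lemma power_sum_eq_0:
  assumes "(y :: 'a) ^ n = 1" "y \<noteq> 1"
  shows "(\<Sum>i<n. y ^ i) = 0"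
  using assms geometric_sum[of y n] by simp

lemma frobenius_card: "(x :: 'a) ^ (3 ^ m) = x"
proof (cases "x = 0")
  case False
  then obtain i where i: "x = \<alpha> ^ i"
    using prim by (auto simp: primitive_elem_def)
  have "x ^ n = (\<alpha> ^ n) ^ i"
    by (simp only: i power_mult [symmetric] mult.commute)
  hence "x ^ n = 1"
    by (simp only: alpha_power_n power_one)
  thus ?thesis
    by (simp add: three_power_m)
qed simp

definition tr :: "'a \<Rightarrow> 'a" where
  "tr x = (\<Sum>t<m. x ^ (3 ^ t))"

text \<open>Cubing shifts the conjugates of \<open>x\<close> cyclically; the two sums are compared
  after adding the conjugate with exponent \<open>3 ^ 0\<close>.\<close>

lemma tr_in_prime_subfield: "tr x \<in> prime_subfield"
proof -
  have "tr x ^ 3 = (\<Sum>t<m. x ^ (3 ^ Suc t))"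
    by (simp add: tr_def cube_sum power_mult [symmetric] mult.commute)
  also have "\<dots> + x ^ (3 ^ 0) = (\<Sum>t<Suc m. x ^ (3 ^ t))"
    by (simp only: sum.lessThan_Suc_shift) simp
  also have "\<dots> = tr x + x"
    by (simp add: tr_def frobenius_card)
  finally show ?thesis
    by (simp add: mem_prime_subfield_iff)
qed

text \<open>As a nonzero polynomial of degree at most \<open>3 ^ (m - 1)\<close>, the trace cannot
  vanish on all \<open>3 ^ m\<close> elements.\<close>

lemma tr_nonzero: "\<exists>x. tr x \<noteq> 0"
proof (rule ccontr)
  assume "\<nexists>x. tr x \<noteq> 0"
  define p :: "'a poly" where "p = (\<Sum>t<m. monom 1 (3 ^ t))"
  have p: "poly p x = tr x" for x
    by (simp add: p_def tr_def poly_sum poly_monom)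
  have "coeff p 1 = (\<Sum>t<m. if t = 0 then 1 else 0)"
    unfolding p_def coeff_sum by (intro sum.cong) auto
  hence "p \<noteq> 0"
    using m_pos by auto
  hence "card {x. poly p x = 0} \<le> degree p"
    by (rule card_poly_roots_bound)
  hence "3 ^ m \<le> degree p"
    using \<open>\<nexists>x. tr x \<noteq> 0\<close> by (simp add: p card_field)
  moreover have "degree p \<le> 3 ^ (m - 1)"
    unfolding p_def
    by (intro degree_sum_le order.trans[OF degree_monom_le] power_increasing) auto
  moreover have "(3::nat) ^ (m - 1) < 3 ^ m"
    using m_pos by simp
  ultimately show False
    by linarith
qed

lemma tr_linear:
  assumes "\<And>i. i \<in> I \<Longrightarrow> v i \<in> prime_subfield"
  shows "(\<Sum>i\<in>I. v i * tr (y i)) = tr (\<Sum>i\<in>I. v i * y i)"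
proof -
  have "(\<Sum>i\<in>I. v i * tr (y i)) = (\<Sum>t<m. \<Sum>i\<in>I. v i * y i ^ (3 ^ t))"
    unfolding tr_def sum_distrib_left by (rule sum.swap)
  also have "\<dots> = (\<Sum>t<m. \<Sum>i\<in>I. (v i * y i) ^ (3 ^ t))"
    using assms by (intro sum.cong) (auto simp: power_mult_distrib prime_subfield_frobenius)
  finally show ?thesis
    by (simp add: tr_def frobenius_sum)
qed

section \<open>Zeros of the code and of its dual\<close>

lemma w3_n: "w3 n = 2 * m"
  using w3_complement[of 0 m] by (simp add: n_def)

text \<open>Oddness of \<open>m\<close> enters here: complementing all digits sends the residue r of
  a digit sum to 2 - r modulo 4.\<close>

lemma two_m_mod_4: "2 * m mod 4 = 2"
proof -
  obtain k where "m = 2 * k + 1"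
    using odd_m by (elim oddE)
  hence "2 * m = 2 + 4 * k"
    by simp
  thus ?thesis
    by (simp only: mod_mult_self2) simp
qed

lemma Z_less_n: "z \<in> Z \<Longrightarrow> z < n"
proof -
  assume z: "z \<in> Z"
  with two_m_mod_4 have "z \<noteq> n"
    by (auto simp: Z_def w3_n)
  with z show ?thesis
    by (auto simp: Z_def three_power_m)
qed

lemma finite_Z: "finite Z"
  using Z_less_n by (auto intro: finite_subset[of _ "{..<n}"])

text \<open>Cubing triples the exponent modulo \<open>n\<close>, which rotates the ternary digits
  and keeps their sum.\<close>

lemma Z_frobenius:
  assumes "z \<in> Z"
  shows "\<exists>z'\<in>Z. (\<alpha> ^ z) ^ (3 ^ t) = \<alpha> ^ z'"
proof (induction t)
  case 0
  with assms show ?case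
    by auto
next
  case (Suc t)
  then obtain z1 where z1: "z1 \<in> Z" "(\<alpha> ^ z) ^ (3 ^ t) = \<alpha> ^ z1"
    by auto
  from m_pos obtain k where k: "m = Suc k"
    by (cases m) auto
  obtain z2 u where z2: "z2 < n" "w3 z2 = w3 z1" "3 * z1 = z2 + u * n"
    using w3_rotate[of z1 k] Z_less_n[OF z1(1)] unfolding n_def k [symmetric] by metis
  have "(\<alpha> ^ z) ^ (3 ^ Suc t) = ((\<alpha> ^ z) ^ (3 ^ t)) ^ 3"
    by (simp add: power_mult [symmetric] mult_ac)
  also have "\<dots> = \<alpha> ^ (3 * z1)"
    by (simp only: z1(2)) (simp only: power_mult [symmetric] mult.commute)
  also have "\<dots> = \<alpha> ^ z2 * (\<alpha> ^ n) ^ u"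
    unfolding z2(3) by (simp only: power_add power_mult [symmetric] mult.commute)
  also have "\<dots> = \<alpha> ^ z2"
    by (simp only: alpha_power_n) simp
  finally have "(\<alpha> ^ z) ^ (3 ^ Suc t) = \<alpha> ^ z2" .
  moreover have "z2 \<in> Z"
    using z1 z2 by (auto simp: Z_def three_power_m)
  ultimately show ?case
    by blast
qed

text \<open>A product equal to 1 forces \<open>z = n - j\<close>, so the digit sums add up to 2
  modulo 4. No residue in {0, 3} and residue in {0, 1} do so.\<close>

lemma Z_T_set_disjoint:
  assumes "z \<in> Z" "j \<in> T_set 0 1 m"
  shows "\<alpha> ^ z * \<alpha> ^ j \<noteq> 1"
proof
  assume "\<alpha> ^ z * \<alpha> ^ j = 1"
  hence "n dvd z + j"
    by (simp only: power_add [symmetric] alpha_power_eq_1_iff)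
  then obtain q where q: "z + j = n * q"
    by (elim dvdE)
  have j: "1 \<le> j" "j \<le> n - 1" "w3 j mod 4 = 0 \<or> w3 j mod 4 = 1"
    using assms(2) by (auto simp: T_set_def n_def)
  have "n * q < n * 2"
    using q j Z_less_n[OF assms(1)] n_ge_2 by linarith
  hence "q < 2"
    by (simp only: mult_less_cancel1)
  moreover have "q \<noteq> 0"
    using q j by (cases q) auto
  ultimately have "q = 1"
    by linarith
  hence "z = n - j"
    using q by simp
  hence "w3 z + w3 j = 2 * m"
    using w3_complement[of j m] j n_ge_2 by (simp add: three_power_m)
  hence "(w3 z mod 4 + w3 j mod 4) mod 4 = 2"
    by (simp only: mod_add_eq two_m_mod_4)
  moreover have "w3 z mod 4 = 0 \<or> w3 z mod 4 = 3"
    using assms(1) by (auto simp: Z_def)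
  ultimately show False
    using j(3) by (elim disjE) (simp_all only:, simp_all)
qed

text \<open>Outside \<open>T_set 0 1 m\<close> a positive exponent has residue 2 or 3, and its
  complement in \<open>n\<close> has residue 0 or 3. The exponent 0 is its own negative and is
  treated apart, because \<open>T_set\<close> starts at 1.\<close>

lemma Z_T_set_cover:
  assumes "e < n" "e \<notin> T_set 0 1 m"
  shows "\<exists>z\<in>Z. inverse \<alpha> ^ e = \<alpha> ^ z"
proof (cases "e = 0")
  case True
  thus ?thesis
    by (intro bexI[of _ 0]) (auto simp: Z_def)
next
  case False
  hence w: "\<not> (w3 e mod 4 = 0 \<or> w3 e mod 4 = 1)"
    using assms by (auto simp: T_set_def three_power_m)
  have "w3 (n - e) + w3 e = 2 * m"
    using w3_complement[of e m] assms(1) by (simp add: three_power_m)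
  hence "(w3 (n - e) mod 4 + w3 e mod 4) mod 4 = 2"
    by (simp only: mod_add_eq two_m_mod_4)
  moreover have "w3 e mod 4 = 2 \<or> w3 e mod 4 = 3"
    using w mod_less_divisor[of 4 "w3 e"] by linarith
  moreover have "w3 (n - e) mod 4 = 0 \<or> w3 (n - e) mod 4 = 1 \<or>
      w3 (n - e) mod 4 = 2 \<or> w3 (n - e) mod 4 = 3"
    using mod_less_divisor[of 4 "w3 (n - e)"] by linarith
  ultimately have "w3 (n - e) mod 4 = 0 \<or> w3 (n - e) mod 4 = 3"
    by (elim disjE) (simp_all only:, simp_all)
  hence "n - e \<in> Z"
    by (auto simp: Z_def three_power_m)
  moreover have "\<alpha> ^ (n - e) * \<alpha> ^ e = 1"
    using assms(1) by (simp only: power_add [symmetric] le_add_diff_inverse2 less_imp_le alpha_power_n)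
  hence "inverse \<alpha> ^ e = \<alpha> ^ (n - e)"
    by (metis inverse_unique mult.commute power_inverse)
  ultimately show ?thesis
    by blast
qed

section \<open>Parity checks of the dual code\<close>

lemma mem_cyc_code_iff:
  "c \<in> cyc_code \<alpha> 0 1 m \<longleftrightarrow>
     c \<in> words n \<and> (\<forall>j\<in>T_set 0 1 m. (\<Sum>i<n. c i * (\<alpha> ^ j) ^ i) = 0)"
proof -
  have sub: "T_set 0 1 m \<subseteq> {..<n}"
    using n_ge_2 by (auto simp: T_set_def n_def)
  have "gen_poly \<alpha> 0 1 m = (\<Prod>a\<in>(^) \<alpha> ` T_set 0 1 m. [:- a, 1:])"
    unfolding gen_poly_def
    by (subst prod.reindex) (use inj_on_subset[OF alpha_power_inj sub] in auto)
  moreover have "finite ((^) \<alpha> ` T_set 0 1 m)"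
    by simp
  ultimately show ?thesis
    by (simp add: cyc_code_def prod_linear_dvd_iff poly_word_poly n_def)
qed

text \<open>
  These words test membership in the dual code: pairing with them for all \<open>\<gamma>\<close> detects the value
  of a word at \<open>\<alpha> ^ z\<close>, since the trace form is nondegenerate.
\<close>
lemma trace_word_in_cyc_code:
  assumes "z \<in> Z"
  shows "(\<lambda>i. if i < n then tr (\<gamma> * (\<alpha> ^ z) ^ i) else 0) \<in> cyc_code \<alpha> 0 1 m"
proof -
  have "(\<Sum>i<n. tr (\<gamma> * (\<alpha> ^ z) ^ i) * (\<alpha> ^ j) ^ i) = 0" if j: "j \<in> T_set 0 1 m" for j
  proof -
    \<comment> \<open>Expanding the trace gives geometric sums whose ratios are
      \<open>\<alpha> ^ z' * \<alpha> ^ j\<close> with \<open>z'\<close> again in \<open>Z\<close>.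
      Such a ratio is an \<open>n\<close>-th root of unity other than 1.\<close>
    have "(\<Sum>i<n. tr (\<gamma> * (\<alpha> ^ z) ^ i) * (\<alpha> ^ j) ^ i)
        = (\<Sum>i<n. \<Sum>t<m. \<gamma> ^ (3 ^ t) * ((\<alpha> ^ z) ^ (3 ^ t) * \<alpha> ^ j) ^ i)"
      by (simp add: tr_def sum_distrib_left power_mult_distrib mult_ac power_mult [symmetric])
    also have "\<dots> = (\<Sum>t<m. \<gamma> ^ (3 ^ t) * (\<Sum>i<n. ((\<alpha> ^ z) ^ (3 ^ t) * \<alpha> ^ j) ^ i))"
      by (subst sum.swap) (simp add: sum_distrib_left)
    also have "\<dots> = 0"
    proof (intro sum.neutral ballI)
      fix t
      obtain z' where z': "z' \<in> Z" "(\<alpha> ^ z) ^ (3 ^ t) = \<alpha> ^ z'"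
        using Z_frobenius[OF assms] by blast
      have "(\<alpha> ^ z' * \<alpha> ^ j) ^ n = (\<alpha> ^ n) ^ (z' + j)"
        by (simp only: power_add [symmetric] power_mult [symmetric] mult.commute[of _ n])
      hence "(\<Sum>i<n. (\<alpha> ^ z' * \<alpha> ^ j) ^ i) = 0"
        by (intro power_sum_eq_0 Z_T_set_disjoint z' j) (simp only: alpha_power_n power_one)
      thus "\<gamma> ^ (3 ^ t) * (\<Sum>i<n. ((\<alpha> ^ z) ^ (3 ^ t) * \<alpha> ^ j) ^ i) = 0"
        by (simp only: z'(2) mult_zero_right)
    qed
    finally show ?thesis .
  qed
  thus ?thesis
    by (auto simp: mem_cyc_code_iff words_def tr_in_prime_subfield zero_in_prime_subfield)
qed

lemma mem_dual_code_iff: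
  "v \<in> dual_code n (cyc_code \<alpha> 0 1 m) \<longleftrightarrow>
     v \<in> words n \<and> (\<forall>z\<in>Z. (\<Sum>i<n. v i * (\<alpha> ^ z) ^ i) = 0)"
proof (intro iffI conjI ballI)
  assume v: "v \<in> dual_code n (cyc_code \<alpha> 0 1 m)"
  thus w: "v \<in> words n"
    by (simp add: dual_code_def)
  fix z assume z: "z \<in> Z"
  define S where "S = (\<Sum>i<n. v i * (\<alpha> ^ z) ^ i)"
  have tr_0: "tr (\<gamma> * S) = 0" for \<gamma>
  proof -
    have "(\<Sum>i<n. v i * (if i < n then tr (\<gamma> * (\<alpha> ^ z) ^ i) else 0)) = 0"
      using bspec[OF _ trace_word_in_cyc_code[OF z, of \<gamma>], of "\<lambda>c. (\<Sum>i<n. v i * c i) = 0"] v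
      by (simp add: dual_code_def)
    hence "(\<Sum>i<n. v i * tr (\<gamma> * (\<alpha> ^ z) ^ i)) = 0"
      by simp
    also have "(\<Sum>i<n. v i * tr (\<gamma> * (\<alpha> ^ z) ^ i)) = tr (\<Sum>i<n. v i * (\<gamma> * (\<alpha> ^ z) ^ i))"
      using w by (intro tr_linear) (auto simp: words_def)
    also have "(\<Sum>i<n. v i * (\<gamma> * (\<alpha> ^ z) ^ i)) = \<gamma> * S"
      by (simp add: S_def sum_distrib_left mult_ac)
    finally show ?thesis .
  qed
  obtain x where "tr x \<noteq> 0"
    using tr_nonzero by blast
  \<comment> \<open>If \<open>S\<close> were nonzero, this multiplier would turn it into
    \<open>x\<close>, whose trace is nonzero.\<close>
  with tr_0[of "x / S"] have "S = 0"
    by (cases "S = 0") auto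
  thus "(\<Sum>i<n. v i * (\<alpha> ^ z) ^ i) = 0"
    by (simp add: S_def)
next
  assume v: "v \<in> words n \<and> (\<forall>z\<in>Z. (\<Sum>i<n. v i * (\<alpha> ^ z) ^ i) = 0)"
  have "(\<Sum>i<n. v i * c i) = 0" if c: "c \<in> cyc_code \<alpha> 0 1 m" for c
  proof -
    \<comment> \<open>Parseval: the pairing of \<open>v\<close> and \<open>c\<close> is a sum of products of their values at inverse points,
      and in each product one factor vanishes.\<close>
    have orth: "(\<Sum>e<n. (inverse \<alpha> ^ i * \<alpha> ^ k) ^ e) = (if k = i then of_nat n else 0)"
      if "i < n" "k < n" for i k
    proof (cases "k = i")
      case False
      have "\<alpha> ^ i \<noteq> \<alpha> ^ k"
        using False that inj_onD[OF alpha_power_inj] by auto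
      hence "inverse \<alpha> ^ i * \<alpha> ^ k \<noteq> 1"
        by (auto simp: power_inverse field_simps)
      moreover have "(inverse \<alpha> ^ i * \<alpha> ^ k) ^ n = inverse (\<alpha> ^ n) ^ i * (\<alpha> ^ n) ^ k"
        by (simp only: power_mult_distrib power_mult [symmetric] power_inverse mult.commute)
      ultimately show ?thesis
        using False power_sum_eq_0 by (simp only: alpha_power_n) simp
    qed (simp add: power_mult_distrib [symmetric])
    have vc: "(\<Sum>i<n. v i * (inverse \<alpha> ^ e) ^ i) * (\<Sum>k<n. c k * (\<alpha> ^ e) ^ k) = 0"
      if e: "e < n" for e
    proof (cases "e \<in> T_set 0 1 m")
      case True
      with c show ?thesis
        by (simp only: mem_cyc_code_iff) simp
    next
      case False
      then obtain z where "z \<in> Z" "inverse \<alpha> ^ e = \<alpha> ^ z"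
        using Z_T_set_cover[OF e] by blast
      with v show ?thesis
        by (simp only: mult_zero_left)
    qed
    have "0 = (\<Sum>e<n. (\<Sum>i<n. v i * (inverse \<alpha> ^ e) ^ i) * (\<Sum>k<n. c k * (\<alpha> ^ e) ^ k))"
      using vc by (simp add: sum.neutral del: mult_eq_0_iff)
    also have "\<dots> = (\<Sum>e<n. \<Sum>i<n. \<Sum>k<n. v i * c k * (inverse \<alpha> ^ i * \<alpha> ^ k) ^ e)"
      unfolding sum_product
      by (intro sum.cong refl) (simp add: power_mult_distrib power_mult [symmetric] mult_ac)
    also have "\<dots> = (\<Sum>i<n. \<Sum>e<n. \<Sum>k<n. v i * c k * (inverse \<alpha> ^ i * \<alpha> ^ k) ^ e)"
      by (rule sum.swap)
    also have "\<dots> = (\<Sum>i<n. \<Sum>k<n. v i * c k * (\<Sum>e<n. (inverse \<alpha> ^ i * \<alpha> ^ k) ^ e))"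
      by (rule sum.cong[OF refl], subst sum.swap) (simp add: sum_distrib_left)
    also have "\<dots> = (\<Sum>i<n. \<Sum>k<n. if k = i then v i * c k * of_nat n else 0)"
      by (intro sum.cong refl) (simp add: orth)
    also have "\<dots> = (\<Sum>i<n. v i * c i) * of_nat n"
      by (simp only: sum.delta' sum.delta finite_lessThan sum_distrib_right lessThan_iff)
        (intro sum.cong, auto)
    \<comment> \<open>In characteristic 3 the length \<open>3 ^ m - 1\<close> is the unit -1, so it
      can be cancelled.\<close>
    also have "of_nat n = (- 1 :: 'a)"
      using m_pos by (simp add: n_def of_nat_diff three_eq_0)
    finally show ?thesis
      by simp
  qed
  with v show "v \<in> dual_code n (cyc_code \<alpha> 0 1 m)"
    by (simp add: dual_code_def)
qed

section \<open>Dimension of the dual code\<close>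

definition F3_polys :: "nat \<Rightarrow> 'a poly set" where
  "F3_polys k = {p. (\<forall>i. coeff p i \<in> prime_subfield) \<and> (\<forall>i\<ge>k. coeff p i = 0)}"

lemma card_F3_polys: "card (F3_polys k) = 3 ^ k"
proof (induction k)
  case 0
  have "F3_polys 0 = {0}"
    by (auto simp: F3_polys_def poly_eq_iff prime_subfield_eq)
  thus ?case
    by simp
next
  case (Suc k)
  have "F3_polys (Suc k) = (\<lambda>(a, p). pCons a p) ` (prime_subfield \<times> F3_polys k)"
  proof (intro equalityI subsetI)
    fix p :: "'a poly" assume p: "p \<in> F3_polys (Suc k)"
    obtain a q where pq: "p = pCons a q"
      by (cases p)
    have "a \<in> prime_subfield"
      using p unfolding F3_polys_def pq by (metis (mono_tags, lifting) coeff_pCons_0 mem_Collect_eq)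
    moreover have "coeff q i \<in> prime_subfield" for i
      using p unfolding F3_polys_def pq by (metis (mono_tags, lifting) coeff_pCons_Suc mem_Collect_eq)
    moreover have "coeff q i = 0" if "i \<ge> k" for i
      using p that unfolding F3_polys_def pq
      by (metis (mono_tags, lifting) coeff_pCons_Suc mem_Collect_eq Suc_le_mono)
    ultimately show "p \<in> (\<lambda>(a, p). pCons a p) ` (prime_subfield \<times> F3_polys k)"
      by (auto simp: F3_polys_def pq)
  next
    fix p :: "'a poly"
    assume "p \<in> (\<lambda>(a, p). pCons a p) ` (prime_subfield \<times> F3_polys k)"
    thus "p \<in> F3_polys (Suc k)"
      by (auto simp: F3_polys_def coeff_pCons split: nat.split)
  qed
  moreover have "inj_on (\<lambda>(a, p). pCons a p) (prime_subfield \<times> F3_polys k)"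
    by (auto simp: inj_on_def)
  ultimately show ?case
    by (simp add: card_image card_cartesian_product card_prime_subfield Suc.IH)
qed

text \<open>The fixed points of this multiplicative map are the polynomials over F_3, so it detects
  subfield coefficients inside \<open>'a poly\<close>.\<close>

definition frob :: "'a poly \<Rightarrow> 'a poly" where
  "frob p = map_poly (\<lambda>x. x ^ 3) p"

lemma coeff_frob: "coeff (frob p) i = coeff p i ^ 3"
  by (simp add: frob_def coeff_map_poly)

lemma frob_eq_iff: "frob p = p \<longleftrightarrow> (\<forall>i. coeff p i \<in> prime_subfield)"
  by (simp add: poly_eq_iff coeff_frob mem_prime_subfield_iff)

lemma frob_mult: "frob (p * q) = frob p * frob q"
  by (rule poly_eqI) (simp add: coeff_frob coeff_mult cube_sum power_mult_distrib)

lemma frob_linear: "frob [:- a, 1:] = [:- (a ^ 3), 1:]"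
  by (simp add: frob_def map_poly_pCons)

lemma frob_prod: "frob (\<Prod>a\<in>A. f a) = (\<Prod>a\<in>A. frob (f a))"
proof (induction A rule: infinite_finite_induct)
  case empty
  thus ?case
    by (simp add: frob_def one_pCons map_poly_pCons)
next
  case (infinite A)
  thus ?case
    by (simp add: frob_def one_pCons map_poly_pCons)
qed (simp add: frob_mult)

definition dual_gen :: "'a poly" where
  "dual_gen = (\<Prod>a\<in>(^) \<alpha> ` Z. [:- a, 1:])"

lemma inj_on_Z: "inj_on ((^) \<alpha>) Z"
  by (rule inj_on_subset[OF alpha_power_inj]) (auto simp: Z_less_n)

lemma dual_gen_nonzero: "dual_gen \<noteq> 0"
  by (simp add: dual_gen_def finite_Z)

lemma degree_dual_gen: "degree dual_gen = card Z"
  by (simp add: dual_gen_def degree_prod_eq_sum_degree card_image inj_on_Z)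

text \<open>Cubing is injective in characteristic 3 and maps the finite root set into itself, hence
  permutes it.\<close>

lemma frob_dual_gen: "frob dual_gen = dual_gen"
proof -
  define R where "R = (^) \<alpha> ` Z"
  have cube_inj: "inj_on (\<lambda>x. x ^ 3) R"
  proof (rule inj_onI)
    fix x y :: 'a assume "x ^ 3 = y ^ 3"
    moreover have "(x + (- y)) ^ 3 = x ^ 3 + (- y) ^ 3"
      by (rule cube_add)
    ultimately have "(x + (- y)) ^ 3 = 0"
      by simp
    thus "x = y"
      by simp
  qed
  have "(\<lambda>x. x ^ 3) ` R \<subseteq> R"
    using Z_frobenius[of _ 1] by (auto simp: R_def)
  hence "(\<lambda>x. x ^ 3) ` R = R"
    using cube_inj by (intro endo_inj_surj) (auto simp: R_def finite_Z)
  have "frob dual_gen = (\<Prod>a\<in>R. [:- (a ^ 3), 1:])"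
    by (simp add: dual_gen_def frob_prod frob_linear R_def)
  also have "\<dots> = (\<Prod>a\<in>(\<lambda>x. x ^ 3) ` R. [:- a, 1:])"
    using cube_inj by (simp add: prod.reindex)
  finally show ?thesis
    by (simp add: \<open>_ ` R = R\<close>) (simp add: R_def dual_gen_def)
qed

lemma F3_polys_iff: "p \<in> F3_polys k \<longleftrightarrow> frob p = p \<and> (p = 0 \<or> degree p < k)"
proof -
  have "(\<forall>i\<ge>k. coeff p i = 0) \<longleftrightarrow> p = 0 \<or> degree p < k"
    by (metis coeff_0 coeff_eq_0 leading_coeff_0_iff linorder_not_less order_less_le_trans)
  thus ?thesis
    by (simp add: F3_polys_def frob_eq_iff)
qed

text \<open>Divisibility is meant over the large field. As \<open>frob\<close> fixes both the
  multiple and \<open>dual_gen\<close>, cancellation shows that it fixes the quotient, which thus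
  lies over F_3.\<close>

lemma dual_gen_multiples:
  "{p \<in> F3_polys n. dual_gen dvd p} = (\<lambda>q. dual_gen * q) ` F3_polys (n - card Z)"
proof (intro equalityI subsetI)
  fix p assume p: "p \<in> {p \<in> F3_polys n. dual_gen dvd p}"
  then obtain q where q: "p = dual_gen * q"
    by (auto elim: dvdE)
  have "dual_gen * frob q = dual_gen * q"
    using p by (simp add: q F3_polys_iff frob_mult frob_dual_gen)
  hence "frob q = q"
    using dual_gen_nonzero by simp
  moreover have "q = 0 \<or> degree q < n - card Z"
    using p dual_gen_nonzero
    by (cases "q = 0") (auto simp: q F3_polys_iff degree_mult_eq degree_dual_gen)
  ultimately show "p \<in> (\<lambda>q. dual_gen * q) ` F3_polys (n - card Z)"
    by (auto simp: q F3_polys_iff)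
next
  fix p assume "p \<in> (\<lambda>q. dual_gen * q) ` F3_polys (n - card Z)"
  then obtain q where "p = dual_gen * q" "q \<in> F3_polys (n - card Z)"
    by auto
  thus "p \<in> {p \<in> F3_polys n. dual_gen dvd p}"
    using dual_gen_nonzero
    by (cases "q = 0")
      (auto simp: F3_polys_iff frob_mult frob_dual_gen degree_mult_eq degree_dual_gen)
qed

lemma card_dual_code: "card (dual_code n (cyc_code \<alpha> 0 1 m)) = 3 ^ (n - card Z)"
proof -
  let ?D = "dual_code n (cyc_code \<alpha> 0 1 m)"
  have D: "v \<in> ?D \<longleftrightarrow> v \<in> words n \<and> dual_gen dvd word_poly n v" for v
    unfolding mem_dual_code_iff dual_gen_def
    by (subst prod_linear_dvd_iff) (auto simp: finite_Z poly_word_poly)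
  have "inj_on (word_poly n) ?D"
  proof (rule inj_onI, rule ext)
    fix v w i assume "v \<in> ?D" "w \<in> ?D" "word_poly n v = word_poly n w"
    thus "v i = w i"
      using coeff_word_poly[of n v i] coeff_word_poly[of n w i]
      by (cases "i < n") (auto simp: D words_def)
  qed
  moreover have "word_poly n ` ?D = {p \<in> F3_polys n. dual_gen dvd p}"
  proof (intro equalityI subsetI)
    fix p assume "p \<in> word_poly n ` ?D"
    thus "p \<in> {p \<in> F3_polys n. dual_gen dvd p}"
      by (auto simp: D F3_polys_def coeff_word_poly words_def zero_in_prime_subfield)
  next
    fix p assume p: "p \<in> {p \<in> F3_polys n. dual_gen dvd p}"
    have "word_poly n (coeff p) = p"
      using p by (auto simp: poly_eq_iff coeff_word_poly F3_polys_def)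
    moreover have "coeff p \<in> words n"
      using p by (auto simp: F3_polys_def words_def)
    ultimately show "p \<in> word_poly n ` ?D"
      using p D[of "coeff p"] by (intro image_eqI[of _ _ "coeff p"]) auto
  qed
  ultimately have "card ?D = card {p \<in> F3_polys n. dual_gen dvd p}"
    by (metis card_image)
  also have "\<dots> = 3 ^ (n - card Z)"
    unfolding dual_gen_multiples using dual_gen_nonzero
    by (subst card_image) (auto simp: inj_on_def card_F3_polys)
  finally show ?thesis .
qed

lemma code_dim_dual_code: "code_dim (dual_code n (cyc_code \<alpha> 0 1 m)) = n - card Z"
proof -
  have "(3::nat) ^ (n - card Z) = 3 ^ k \<longleftrightarrow> k = n - card Z" for k
    by (subst power_inject_exp) auto
  thus ?thesis
    unfolding code_dim_def card_dual_code by simp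
qed

lemma card_Z: "card Z = w3_count m 0 + w3_count m 3"
proof -
  have Z: "Z = {z. z < 3 ^ m \<and> w3 z mod 4 = 0} \<union> {z. z < 3 ^ m \<and> w3 z mod 4 = 3}"
    by (auto simp: Z_def)
  have "{z. z < 3 ^ m \<and> w3 z mod 4 = 0} \<inter> {z. z < 3 ^ m \<and> w3 z mod 4 = 3} = {}"
    by (force simp del: mod_0_imp_dvd)
  thus ?thesis
    unfolding w3_count_def Z by (intro card_Un_disjoint) simp_all
qed

lemma dim_1_mod_4:
  assumes "m mod 4 = 1"
  shows "n - card Z = n div 2"
proof -
  define k where "k = m div 4"
  have "m = 4 * k + 1"
    using assms div_mult_mod_eq[of m 4] by (simp add: k_def)
  with w3_count_1_mod_4[of k] have "w3_count m 0 = w3_count m 3 + 1" "3 ^ m = 4 * w3_count m 3 + 3"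
    by simp_all
  thus ?thesis
    by (simp add: card_Z n_def)
qed

lemma dim_3_mod_4:
  assumes "m mod 4 = 3"
  shows "n - card Z = (n - 2) div 2"
proof -
  define k where "k = m div 4"
  have "m = 4 * k + 3"
    using assms div_mult_mod_eq[of m 4] by (simp add: k_def)
  with w3_count_3_mod_4[of k] have "4 * w3_count m 0 = 3 ^ m + 1" "4 * w3_count m 3 = 3 ^ m + 1"
    by simp_all
  hence "4 * w3_count m 0 = n + 2" "4 * w3_count m 3 = n + 2"
    by (simp_all add: three_power_m)
  hence "n - 2 = 2 * (n - card Z)"
    unfolding card_Z by linarith
  thus ?thesis
    by simp
qed

section \<open>From weights of words to the minimum distance\<close>

lemma dual_code_min_distI:
  assumes "\<And>v. v \<in> dual_code n (cyc_code \<alpha> 0 1 m) \<Longrightarrow> v \<noteq> (\<lambda>_. 0) \<Longrightarrow> b \<le> real (hweight n v)"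
    and "n - card Z > 0"
  shows "b \<le> real (min_dist n (dual_code n (cyc_code \<alpha> 0 1 m)))"
proof -
  let ?D = "dual_code n (cyc_code \<alpha> 0 1 m)"
  let ?W = "{hweight n c | c. c \<in> ?D \<and> c \<noteq> (\<lambda>_. 0)}"
  have "finite ?W"
  proof (rule finite_subset)
    show "?W \<subseteq> {..n}"
    proof
      fix k assume "k \<in> ?W"
      then obtain c where "k = card {i. i < n \<and> c i \<noteq> (0::'a)}"
        by (auto simp: hweight_def)
      moreover have "card {i. i < n \<and> c i \<noteq> 0} \<le> card {..<n}"
        by (intro card_mono) auto
      ultimately show "k \<in> {..n}"
        by simp
    qed
  qed simp
  \<comment> \<open>Positive dimension provides at least three words, hence a nonzero one; otherwise
    \<open>Min\<close> would be applied to the empty set.\<close>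
  moreover have "?W \<noteq> {}"
  proof
    assume "?W = {}"
    hence "?D \<subseteq> {\<lambda>_. 0}"
      by auto
    hence "card ?D \<le> 1"
      using card_mono[of "{\<lambda>_. 0}" ?D] by simp
    moreover have "(3::nat) ^ 1 \<le> 3 ^ (n - card Z)"
      using assms(2) by (intro power_increasing) auto
    ultimately show False
      by (simp add: card_dual_code)
  qed
  ultimately have "min_dist n ?D \<in> ?W"
    unfolding min_dist_def by (rule Min_in)
  thus ?thesis
    using assms(1) by auto
qed

lemma dual_code_vanishes:
  assumes "v \<in> dual_code n (cyc_code \<alpha> 0 1 m)" "\<alpha> ^ j = \<alpha> ^ z" "z \<in> Z"
  shows "(\<Sum>i<n. v i * (\<alpha> ^ j) ^ i) = 0"
  using assms by (simp add: mem_dual_code_iff)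

lemma two_nonzero: "(2::'a) \<noteq> 0"
  by (simp add: two_eq)

end

section \<open>Folding a word onto its first half\<close>

locale ternary_primitive_odd = ternary_primitive +
  fixes h :: nat
  assumes m_eq: "m = 2 * h + 1" and h_pos: "h > 0"
begin

definition N :: nat where "N = n div 2"

definition s :: nat where "s = 3 ^ h - 1"

lemma s_eq: "s = 2 * (s div 2)"
proof -
  have "even s"
    by (simp add: s_def)
  thus ?thesis
    by simp
qed

text \<open>This form exhibits \<open>N\<close> as 1 plus a multiple of \<open>s div 2\<close>, so
  the two are coprime.\<close>

lemma N_eq: "N = 3 * (3 ^ h + 1) * (s div 2) + 1"
proof -
  have "(3::nat) ^ h = 2 * (s div 2) + 1"
    using s_eq by (simp add: s_def)
  moreover have "(3::nat) ^ m = 3 * (3 ^ h * 3 ^ h)"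
    by (simp add: m_eq mult_2 power_add)
  ultimately have "3 ^ m = 2 * (3 * (3 ^ h + 1) * (s div 2) + 1) + 1"
    by (simp add: algebra_simps)
  thus ?thesis
    by (simp add: N_def n_def)
qed

lemma n_eq: "n = 2 * N"
proof -
  have "even n"
    by (simp add: n_def)
  thus ?thesis
    by (simp add: N_def)
qed

lemma alpha_power_N: "\<alpha> ^ N = - 1"
proof -
  have "(\<alpha> ^ N) ^ 2 = 1"
    using alpha_power_n by (simp add: n_eq power_mult [symmetric] mult.commute)
  moreover have "\<not> n dvd N"
    using n_ge_2 n_eq by (auto dest: dvd_imp_le)
  hence "\<alpha> ^ N \<noteq> 1"
    by (simp add: alpha_power_eq_1_iff)
  ultimately show ?thesis
    by (simp add: power2_eq_1_iff)
qed

text \<open>After dividing \<open>s\<close> and \<open>n\<close> by 2, the step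
  \<open>s div 2\<close> is invertible modulo \<open>N\<close>; thus \<open>\<alpha> ^ s\<close> has
  order \<open>N\<close>.\<close>

lemma locators_inj: "inj_on (\<lambda>i. (\<alpha> ^ s) ^ i) {..<N}"
proof (rule inj_onI)
  fix i j assume ij: "i \<in> {..<N}" "j \<in> {..<N}" and "(\<alpha> ^ s) ^ i = (\<alpha> ^ s) ^ j"
  hence "\<alpha> ^ (s * i) = \<alpha> ^ (s * j)"
    by (simp add: power_mult)
  hence "int n dvd int s * (int i - int j)"
    by (simp add: alpha_power_eq_iff algebra_simps)
  moreover have "int s = 2 * int (s div 2)" "int n = 2 * int N"
    using s_eq n_eq by linarith+
  ultimately have dvd: "int N dvd int (s div 2) * (int i - int j)"
    by (simp add: mult.assoc)
  have "coprime (int N) (int (s div 2))"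
  proof (rule coprimeI)
    fix c assume "c dvd int N" "c dvd int (s div 2)"
    moreover have "int N = 3 * (3 ^ h + 1) * int (s div 2) + 1"
      by (simp add: N_eq)
    ultimately show "is_unit c"
      by (metis dvd_add_right_iff dvd_mult)
  qed
  with dvd have "int N dvd int i - int j"
    by (simp add: coprime_dvd_mult_right_iff)
  with ij show "i = j"
    by (auto intro: dvd_int_diff_imp_eq)
qed

lemma sum_halves: "(\<Sum>i<n. f i) = (\<Sum>i<N. f i + (f (i + N) :: 'a))"
proof -
  have "(\<Sum>i<N + k. f i) = (\<Sum>i<N. f i) + (\<Sum>i<k. f (i + N))" for k
    by (induction k) (simp_all add: add_ac)
  from this[of N] show ?thesis
    by (simp add: n_eq mult_2 sum.distrib)
qed

text \<open>Since \<open>s\<close> is even, all exponents \<open>b + s * k\<close> have the parity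
  of \<open>b\<close>. With \<open>\<alpha> ^ N = - 1\<close>, position \<open>i + N\<close>
  contributes like position \<open>i\<close> up to the sign \<open>(- 1) ^ b\<close>. Merging them
  leaves \<open>N\<close> positions with distinct locators; the nonzero factor
  \<open>(\<alpha> ^ b) ^ i\<close> absorbs the start of the progression.\<close>

lemma folded_weight_bound:
  assumes zeros: "\<And>k. k < \<delta> \<Longrightarrow> (\<Sum>i<n. v i * (\<alpha> ^ (b + s * k)) ^ i) = 0"
    and "i0 < N" "v i0 + (- 1) ^ b * v (i0 + N) \<noteq> 0"
  shows "card {i. i < N \<and> v i + (- 1) ^ b * v (i + N) \<noteq> 0} > \<delta>"
proof -
  define f where "f i = (v i + (- 1) ^ b * v (i + N)) * (\<alpha> ^ b) ^ i" for i
  have "(\<Sum>i<N. f i * ((\<alpha> ^ s) ^ i) ^ k) = 0" if k: "k < \<delta>" for k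
  proof -
    have shift: "(\<alpha> ^ (b + s * k)) ^ (i + N) = (- 1) ^ b * (\<alpha> ^ (b + s * k)) ^ i" for i
    proof -
      have "(\<alpha> ^ (b + s * k)) ^ N = (\<alpha> ^ N) ^ (b + s * k)"
        by (simp only: power_mult [symmetric] mult.commute)
      also have "\<dots> = (- 1) ^ b * ((- 1) ^ s) ^ k"
        by (simp only: alpha_power_N power_add power_mult)
      also have "(- 1 :: 'a) ^ s = 1"
        by (intro neg_one_even_power) (simp add: s_def)
      finally show ?thesis
        by (simp only: power_add [of _ i N] power_one mult_1_right mult_1_left mult.commute)
    qed
    have "f i * ((\<alpha> ^ s) ^ i) ^ k
        = v i * (\<alpha> ^ (b + s * k)) ^ i + v (i + N) * (\<alpha> ^ (b + s * k)) ^ (i + N)" for i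
    proof -
      have "(\<alpha> ^ (b + s * k)) ^ i = (\<alpha> ^ b) ^ i * ((\<alpha> ^ s) ^ i) ^ k"
        by (simp add: power_add power_mult [symmetric] power_mult_distrib mult_ac)
      thus ?thesis
        unfolding shift by (simp add: f_def algebra_simps)
    qed
    hence "(\<Sum>i<N. f i * ((\<alpha> ^ s) ^ i) ^ k) = (\<Sum>i<n. v i * (\<alpha> ^ (b + s * k)) ^ i)"
      by (simp add: sum_halves)
    with zeros[OF k] show ?thesis
      by simp
  qed
  hence "card {i\<in>{..<N}. f i \<noteq> 0} > \<delta>"
    using assms(2,3) locators_inj
    by (intro vandermonde_weight_bound[where x = "\<lambda>i. (\<alpha> ^ s) ^ i" and ?i0.0 = i0])
      (auto simp: f_def)
  thus ?thesis
    by (simp add: f_def)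
qed

lemma zeros_in_progression:
  assumes v: "v \<in> dual_code n (cyc_code \<alpha> 0 1 m)" and "k < 3 ^ g" "g \<le> h" "E < 3"
    and "(2 * g + E) mod 4 = 0 \<or> (2 * g + E) mod 4 = 3"
  shows "(\<Sum>i<n. v i * (\<alpha> ^ (3 ^ g - 1 + 3 ^ (h + g) * E + s * k)) ^ i) = 0"
proof (rule dual_code_vanishes[OF v refl])
  let ?z = "3 ^ g - 1 + 3 ^ (h + g) * E + s * k"
  obtain x y where x: "(3::nat) ^ g = Suc x" and y: "(3::nat) ^ h = Suc y"
    by (metis gr0_conv_Suc zero_less_numeral zero_less_power)
  have "(3::nat) ^ (h + g) * E \<le> 3 ^ (h + g) * 2"
    using assms by (intro mult_left_mono) auto
  moreover have "s * k \<le> s * x"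
    using assms x by (intro mult_left_mono) auto
  \<comment> \<open>The extreme case is top digit 2 and \<open>k = 3 ^ g - 1\<close>; it still fits
    into \<open>h + g + 1\<close> digits, at most \<open>m\<close>.\<close>
  ultimately have "?z \<le> 3 ^ g - 1 + 3 ^ (h + g) * 2 + s * x"
    by linarith
  also have "\<dots> < 3 ^ (h + g) * 3"
    by (simp add: x y s_def power_add)
  also have "\<dots> = 3 ^ (h + g + 1)"
    by (simp add: power_add)
  also have "\<dots> \<le> 3 ^ m"
    using assms by (intro power_increasing) (auto simp: m_eq)
  finally have "?z < 3 ^ m" .
  moreover have "w3 ?z = 2 * g + E"
    using w3_complementary_blocks[OF assms(2,3), of E] assms(4) by (simp add: s_def w3_small)
  ultimately show "?z \<in> Z"
    using assms(5) by (auto simp: Z_def)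
qed

text \<open>An even \<open>E\<close> makes the start even, which bounds the sum of the halves; 0 or
  2 is taken to make the digit sum 0 modulo 4. If that sum vanishes, the top digit 1 gives an odd
  start and digit sum 3 modulo 4, which bounds the difference of the halves.\<close>

lemma weight_bound:
  assumes v: "v \<in> dual_code n (cyc_code \<alpha> 0 1 m)" "v \<noteq> (\<lambda>_. 0)"
    and E: "E = 0 \<or> E = 2" "(2 * h + E) mod 4 = 0"
    and g: "g \<le> h" "(2 * g + 1) mod 4 = 3"
  shows "hweight n v > 3 ^ h \<or> hweight n v \<ge> 2 * (3 ^ g + 1)"
proof (cases "\<exists>i0<N. v i0 + v (i0 + N) \<noteq> 0")
  case True
  then obtain i0 where i0: "i0 < N" "v i0 + v (i0 + N) \<noteq> 0"
    by blast
  define b where "b = 3 ^ h - 1 + 3 ^ (h + h) * E"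
  have b: "(- 1 :: 'a) ^ b = 1"
    using E by (intro neg_one_even_power) (auto simp: b_def)
  have "card {i. i < N \<and> v i + (- 1) ^ b * v (i + N) \<noteq> 0} > 3 ^ h"
  proof (rule folded_weight_bound)
    fix k :: nat assume "k < 3 ^ h"
    thus "(\<Sum>i<n. v i * (\<alpha> ^ (b + s * k)) ^ i) = 0"
      unfolding b_def using E by (intro zeros_in_progression v) auto
  qed (use i0 b in auto)
  \<comment> \<open>A nonzero folded value needs a nonzero entry at \<open>i\<close> or at
    \<open>i + N\<close>; the map selects one of them.\<close>
  also have "card {i. i < N \<and> v i + (- 1) ^ b * v (i + N) \<noteq> 0} \<le> hweight n v"
    unfolding hweight_def
    by (rule card_inj_on_le[where f = "\<lambda>i. if v i \<noteq> 0 then i else i + N"])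
      (auto simp: inj_on_def n_eq)
  finally show ?thesis ..
next
  case False
  hence anti: "v (i + N) = - v i" if "i < N" for i
    using that by (simp add: eq_neg_iff_add_eq_0 add.commute)
  define b where "b = 3 ^ g - 1 + 3 ^ (h + g) * (1::nat)"
  have b: "(- 1 :: 'a) ^ b = - 1"
    by (intro neg_one_odd_power) (auto simp: b_def)
  have fold: "v i + (- 1) ^ b * v (i + N) = 2 * v i" if "i < N" for i
    using anti[OF that] by (simp add: b)
  have "\<exists>i0<N. v i0 \<noteq> 0"
  proof (rule ccontr)
    assume *: "\<not> (\<exists>i0<N. v i0 \<noteq> 0)"
    have "v i = 0" for i
    proof (cases "i < n")
      case True
      hence "i < N \<or> (\<exists>j<N. i = j + N)"
        by (auto simp: n_eq intro: exI[of _ "i - N"])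
      with * anti show ?thesis
        by auto
    next
      case False
      with v(1) show ?thesis
        by (simp add: dual_code_def words_def)
    qed
    with v(2) show False
      by blast
  qed
  then obtain i0 where i0: "i0 < N" "v i0 \<noteq> 0"
    by blast
  define S where "S = {i. i < N \<and> v i \<noteq> 0}"
  have "card {i. i < N \<and> v i + (- 1) ^ b * v (i + N) \<noteq> 0} > 3 ^ g"
  proof (rule folded_weight_bound)
    fix k :: nat assume "k < 3 ^ g"
    thus "(\<Sum>i<n. v i * (\<alpha> ^ (b + s * k)) ^ i) = 0"
      unfolding b_def using g by (intro zeros_in_progression v) auto
  qed (use i0 fold two_nonzero in auto)
  also have "{i. i < N \<and> v i + (- 1) ^ b * v (i + N) \<noteq> 0} = S"
    using fold two_nonzero by (auto simp: S_def)
  finally have "card S > 3 ^ g" .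
  \<comment> \<open>The second half is the negative of the first, so every support position counts
    twice.\<close>
  moreover have "card S + card ((\<lambda>i. i + N) ` S) = card (S \<union> (\<lambda>i. i + N) ` S)"
    by (rule card_Un_disjoint [symmetric]) (auto simp: S_def)
  moreover have "card ((\<lambda>i. i + N) ` S) = card S"
    by (intro card_image) auto
  moreover have "card (S \<union> (\<lambda>i. i + N) ` S) \<le> hweight n v"
    unfolding hweight_def by (intro card_mono) (auto simp: S_def n_eq anti)
  ultimately have "hweight n v \<ge> 2 * (3 ^ g + 1)"
    by simp
  thus ?thesis ..
qed

end

text \<open>For \<open>h = 1\<close> folding guarantees only weight 4, but 6 is required. The
  progression from 5 with step 21 runs through 5, 0, 21, 16, 11 modulo 26; 21 is a unit there, so
  five zeros bound the weight without folding.\<close>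

lemma (in ternary_primitive) weight_bound_m_3:
  assumes "m = 3" and v: "v \<in> dual_code n (cyc_code \<alpha> 0 1 m)" "v \<noteq> (\<lambda>_. 0)"
  shows "hweight n v \<ge> 6"
proof -
  have n: "n = 26"
    using assms(1) unfolding n_def by simp
  obtain i0 where i0: "v i0 \<noteq> 0"
    using v(2) by blast
  hence "i0 < n"
    using v(1) by (metis (mono_tags, lifting) dual_code_def mem_Collect_eq not_le words_def)
  have w3: "w3 5 = 3" "w3 21 = 3" "w3 16 = 4" "w3 11 = 3"
    using w3_digit[of 2 1] w3_digit[of 0 7] w3_digit[of 1 2] w3_digit[of 1 5]
      w3_digit[of 2 3] w3_digit[of 0 1] w3_small[of 1] w3_small[of 2]
    by simp_all
  have Z: "5 \<in> Z" "0 \<in> Z" "21 \<in> Z" "16 \<in> Z" "11 \<in> Z"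
    unfolding Z_def using assms(1) w3 by simp_all
  have "\<exists>z\<in>Z. \<alpha> ^ (5 + 21 * k) = \<alpha> ^ z" if k: "k < 5" for k
  proof -
    have "k = 0 \<or> k = 1 \<or> k = 2 \<or> k = 3 \<or> k = 4"
      using k by linarith
    hence "\<exists>z\<in>Z. int n dvd int (5 + 21 * k) - int z"
      using Z unfolding n by (elim disjE; force)
    thus ?thesis
      by (simp only: alpha_power_eq_iff)
  qed
  hence zeros: "(\<Sum>i<n. v i * (\<alpha> ^ (5 + 21 * k)) ^ i) = 0" if "k < 5" for k
    using dual_code_vanishes[OF v(1)] that by blast
  have "inj_on (\<lambda>i. (\<alpha> ^ 21) ^ i) {..<n}"
  proof (rule inj_onI)
    fix i j assume ij: "i \<in> {..<n}" "j \<in> {..<n}" and "(\<alpha> ^ 21) ^ i = (\<alpha> ^ 21) ^ j"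
    hence "\<alpha> ^ (21 * i) = \<alpha> ^ (21 * j)"
      by (simp only: power_mult)
    hence "26 dvd 21 * (int i - int j)"
      by (simp add: alpha_power_eq_iff n)
    \<comment> \<open>5 inverts 21 modulo 26, as 5 * 21 = 4 * 26 + 1.\<close>
    hence "26 dvd 5 * (21 * (int i - int j)) - 26 * (4 * (int i - int j))"
      by (rule dvd_diff[OF dvd_mult dvd_triv_left])
    hence "int n dvd int i - int j"
      by (simp add: n)
    with ij show "i = j"
      by (auto intro: dvd_int_diff_imp_eq)
  qed
  moreover have "(\<Sum>i<n. (v i * (\<alpha> ^ 5) ^ i) * ((\<alpha> ^ 21) ^ i) ^ k) = 0" if "k < 5" for k
    using zeros[OF that]
    by (simp add: power_add power_mult_distrib power_mult [symmetric] mult_ac)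
  ultimately have "card {i\<in>{..<n}. v i * (\<alpha> ^ 5) ^ i \<noteq> 0} > 5"
    using i0 \<open>i0 < n\<close>
    by (intro vandermonde_weight_bound[where x = "\<lambda>i. (\<alpha> ^ 21) ^ i" and ?i0.0 = i0]) auto
  thus ?thesis
    by (simp add: hweight_def)
qed

section \<open>Choice of progressions for the two residues of m modulo 4\<close>

theorem theorem9:
  fixes \<alpha> :: "'a::{field,finite}" and m :: nat
  assumes "card (UNIV :: 'a set) = 3 ^ m"
    and "primitive_elem \<alpha>"
    and "m \<ge> 3" and "odd m"
  shows "let n = 3 ^ m - 1; D = dual_code n (cyc_code \<alpha> 0 1 m) in
    (m mod 4 = 3 \<longrightarrow>
       real (min_dist n D) \<ge> (3 ^ ((m - 1) div 2) + 9) / 2 \<and> code_dim D = (n - 2) div 2) \<and>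
    (m mod 4 = 1 \<longrightarrow>
       real (min_dist n D) \<ge> (3 ^ ((m - 1) div 2) + 7) / 2 \<and> code_dim D = n div 2)"
proof -
  define h where "h = (m - 1) div 2"
  have m: "m = 2 * h + 1" and h: "h > 0"
    using assms(3,4) by (auto simp: h_def elim!: oddE)
  interpret ternary_primitive_odd \<alpha> m h
    using assms m h by unfold_locales auto
  let ?D = "dual_code n (cyc_code \<alpha> 0 1 m)"
  have "(3::nat) ^ 3 \<le> 3 ^ m"
    using assms(3) by (intro power_increasing) auto
  hence n: "n \<ge> 26"
    by (simp add: n_def)
  have A: "(3 ^ h + 9) / 2 \<le> real (min_dist n ?D) \<and> code_dim ?D = (n - 2) div 2"
    if "m mod 4 = 3"
  proof
    show "code_dim ?D = (n - 2) div 2"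
      by (simp add: code_dim_dual_code dim_3_mod_4[OF that])
    show "(3 ^ h + 9) / 2 \<le> real (min_dist n ?D)"
    proof (rule dual_code_min_distI)
      show "0 < n - card Z"
        using n by (simp add: dim_3_mod_4[OF that])
    next
      fix v assume v: "v \<in> ?D" "v \<noteq> (\<lambda>_. 0)"
      show "(3 ^ h + 9) / 2 \<le> real (hweight n v)"
      proof (cases "m = 3")
        case True
        hence "h = 1"
          using m by simp
        with weight_bound_m_3[OF True v] show ?thesis
          by simp
      next
        case False
        have "odd h"
          using that m by presburger
        hence mods: "(2 * h + 2) mod 4 = 0" "(2 * h + 1) mod 4 = 3"
          by presburger+
        \<comment> \<open>For odd \<open>h\<close> the choice is \<open>E = 2\<close> and
          \<open>g = h\<close>; the weight \<open>3 ^ h + 1\<close> suffices once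
          \<open>3 ^ h\<close> is at least 7.\<close>
        have "h \<ge> 2"
          using False m h by linarith
        hence "(3::nat) ^ 2 \<le> 3 ^ h"
          by (intro power_increasing) auto
        hence "3 ^ h + 9 \<le> 2 * hweight n v"
          using weight_bound[OF v _ mods(1) order.refl mods(2)] by auto
        hence "real (3 ^ h + 9) \<le> real (2 * hweight n v)"
          by (simp only: of_nat_le_iff)
        thus ?thesis
          by simp
      qed
    qed
  qed
  have B: "(3 ^ h + 7) / 2 \<le> real (min_dist n ?D) \<and> code_dim ?D = n div 2"
    if "m mod 4 = 1"
  proof
    show "code_dim ?D = n div 2"
      by (simp add: code_dim_dual_code dim_1_mod_4[OF that])
    show "(3 ^ h + 7) / 2 \<le> real (min_dist n ?D)"
    proof (rule dual_code_min_distI)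
      show "0 < n - card Z"
        using n by (simp add: dim_1_mod_4[OF that])
    next
      fix v assume v: "v \<in> ?D" "v \<noteq> (\<lambda>_. 0)"
      \<comment> \<open>The second progression needs \<open>g\<close> odd, so for even
        \<open>h\<close> the largest choice is \<open>h - 1\<close>. Its bound
        \<open>2 * (3 ^ g + 1)\<close> suffices because \<open>3 ^ g\<close> is at least 3.\<close>
      obtain g where g: "h = Suc g"
        using h by (cases h) auto
      have "even h"
        using that m by presburger
      hence mods: "(2 * h + 0) mod 4 = 0" "(2 * g + 1) mod 4 = 3"
        using g by presburger+
      have "g \<ge> 1"
        using \<open>even h\<close> g by (cases g) auto
      hence "(3::nat) ^ 1 \<le> 3 ^ g"
        by (intro power_increasing) auto
      moreover have "(3::nat) ^ h = 3 * 3 ^ g"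
        by (simp add: g)
      moreover have "hweight n v > 3 ^ h \<or> hweight n v \<ge> 2 * (3 ^ g + 1)"
        using weight_bound[OF v _ mods(1) _ mods(2)] g by auto
      ultimately have "3 ^ h + 7 \<le> 2 * hweight n v"
        by auto
      hence "real (3 ^ h + 7) \<le> real (2 * hweight n v)"
        by (simp only: of_nat_le_iff)
      thus "(3 ^ h + 7) / 2 \<le> real (hweight n v)"
        by simp
    qed
  qed
  show ?thesis
    using A B unfolding Let_def n_def h_def by blast
qed

end
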